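(* Let $d\in\{2,3\}$. Let $\psi:[-1,1]\to\mathbb{R}_{\ge0}$ be Lipschitz with constant $L_\psi$, and let $\mathcal{D}=\{\mathbf{d}_i\}_{i=1}^n$, $\mathcal{D}'=\{\mathbf{d}_i'\}_{i=1}^n$ be two directional bases in $\mathbb{S}^{d-1}$. Set $$\delta:=\max_i\|\mathbf{d}_i-\mathbf{d}_i'\|_2,\qquad Z_{\min}:=\inf_{\boldsymbol\theta\in\mathbb{S}^{d-1}}\min\Bigl(\sum_j\psi(\boldsymbol\theta^\top\mathbf{d}_j),\ \sum_j\psi(\boldsymbol\theta^\top\mathbf{d}_j')\Bigr),$$ and assume $Z_{\min}>0$. Let $f=f_{\mathbf{p}}\in L^1(\mathbb{S}^{d-1})$ be the environment signal at a point $\mathbf{p}$, and let $\phi_i(\mathbf{p})$, $\phi_i'(\mathbf{p})$ and $\mathbf{F}(\mathbf{p})$, $\mathbf{F}'(\mathbf{p})$ be the feature components and feature vectors of $f$ computed with the weights of $\mathcal{D}$ and $\mathcal{D}'$, respectively. Then for every $i=1,\dots,n$, $$|\phi_i(\mathbf{p})-\phi_i'(\mathbf{p})|\le\frac{(n+1)L_\psi}{Z_{\min}}\,\|f\|_{L^1}\,\delta,$$ and consequently $$\|\mathbf{F}(\mathbf{p})-\mathbf{F}'(\mathbf{p})\|_2\le\frac{(n+1)\sqrt{n}\,L_\psi}{Z_{\min}}\,\|f\|_{L^1}\,\delta.$$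
   Context: $\mathbb{S}^{d-1}$ is the unit sphere of $\mathbb{R}^d$ with standard surface measure $\sigma$. A directional basis is an indexed finite set of unit vectors. For a kernel $\psi$ and a basis $\{\mathbf{d}_i\}_{i=1}^n$ the partition-of-unity weights are $w_i(\boldsymbol\theta)=\psi(\boldsymbol\theta^\top\mathbf{d}_i)/\sum_{j=1}^n\psi(\boldsymbol\theta^\top\mathbf{d}_j)$ (and $w_i'$ likewise for $\{\mathbf{d}_i'\}$). The feature components are $\phi_i(\mathbf{p})=\int_{\mathbb{S}^{d-1}}f\,w_i\,\mathrm{d}\sigma$ and $\phi_i'(\mathbf{p})=\int_{\mathbb{S}^{d-1}}f\,w_i'\,\mathrm{d}\sigma$; the feature vectors are $\mathbf{F}(\mathbf{p})=[\phi_1(\mathbf{p}),\dots,\phi_n(\mathbf{p})]^\top$ and $\mathbf{F}'(\mathbf{p})=[\phi_1'(\mathbf{p}),\dots,\phi_n'(\mathbf{p})]^\top$. *)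

theory Defs
  imports "HOL-Analysis.Analysis"
begin

text \<open>
  Surface measure on the unit sphere of a \<open>d\<close>-dimensional Euclidean space, by polar
  coordinates: \<open>\<sigma>(A) = d \<cdot> vol {r a | 0 < r < 1, a \<in> A}\<close>. The underlying space is the sphere
  with its Borel sets, and \<open>\<sigma>\<close> is not normalised: the total mass is \<open>2\<pi>\<close> for \<open>d = 2\<close> and
  \<open>4\<pi>\<close> for \<open>d = 3\<close>, see below.
\<close>

definition sphere_measure :: "'a::euclidean_space measure" where
  "sphere_measure =
     distr (scale_measure (of_nat DIM('a)) (restrict_space lborel (ball 0 1 - {0})))
       (restrict_space borel (sphere 0 1)) (\<lambda>x. x /\<^sub>R norm x)"

lemma space_sphere_measure [simp]: "space sphere_measure = sphere 0 1"
  by (simp add: sphere_measure_def space_restrict_space)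

lemma sets_sphere_measure [simp, measurable_cong]:
  "sets sphere_measure = sets (restrict_space borel (sphere 0 1))"
  by (simp add: sphere_measure_def)

lemma emeasure_sphere_measure:
  fixes A :: "'a::euclidean_space set"
  assumes "A \<in> sets borel" "A \<subseteq> sphere 0 1"
  shows "emeasure sphere_measure A =
    of_nat DIM('a) * emeasure lborel {x \<in> ball 0 1 - {0}. x /\<^sub>R norm x \<in> A}"
proof -
  let ?B = "ball (0::'a) 1 - {0}"
  let ?R = "restrict_space lborel ?B"
  have B: "?B \<in> sets borel" by simp
  have m: "(\<lambda>x::'a. x /\<^sub>R norm x) \<in> measurable (scale_measure (of_nat DIM('a)) ?R)
             (restrict_space borel (sphere 0 1))"
  proof (rule measurable_restrict_space2)
    show "(\<lambda>x::'a. x /\<^sub>R norm x) \<in> borel_measurable (scale_measure (of_nat DIM('a)) ?R)"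
      unfolding measurable_cong_sets[OF sets_scale_measure refl]
      by (rule measurable_restrict_space1) simp
  qed (auto simp: space_scale_measure space_restrict_space)
  have "A \<in> sets (restrict_space borel (sphere 0 1))"
    using assms by (auto simp: sets_restrict_space)
  then have "emeasure sphere_measure A =
      emeasure (scale_measure (of_nat DIM('a)) ?R)
        ((\<lambda>x. x /\<^sub>R norm x) -` A \<inter> space (scale_measure (of_nat DIM('a)) ?R))"
    unfolding sphere_measure_def by (rule emeasure_distr[OF m])
  also have "(\<lambda>x. x /\<^sub>R norm x) -` A \<inter> space (scale_measure (of_nat DIM('a)) ?R) =
      {x \<in> ?B. x /\<^sub>R norm x \<in> A}"
    by (auto simp: space_scale_measure space_restrict_space)
  also have "emeasure (scale_measure (of_nat DIM('a)) ?R) \<dots> =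
      of_nat DIM('a) * emeasure lborel {x \<in> ?B. x /\<^sub>R norm x \<in> A}"
    unfolding emeasure_scale_measure
    by (subst emeasure_restrict_space) auto
  finally show ?thesis .
qed

lemma emeasure_sphere_measure_UNIV:
  "emeasure (sphere_measure :: 'a::euclidean_space measure) (sphere 0 1) =
     ennreal (DIM('a) * unit_ball_vol DIM('a))"
proof -
  have "{x \<in> ball (0::'a) 1 - {0}. x /\<^sub>R norm x \<in> sphere 0 1} = ball 0 1 - {0}"
    by auto
  then have "emeasure (sphere_measure :: 'a measure) (sphere 0 1) =
      of_nat DIM('a) * emeasure lborel (ball (0::'a) 1 - {0})"
    by (simp add: emeasure_sphere_measure)
  also have "emeasure lborel (ball (0::'a) 1 - {0}) = emeasure lborel (ball (0::'a) 1)"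
    by (rule emeasure_Diff_null_set) auto
  finally show ?thesis
    by (simp add: emeasure_ball ennreal_mult ennreal_of_nat_eq_real_of_nat)
qed

lemma sphere_measure_circle:
  "DIM('a::euclidean_space) = 2 \<Longrightarrow>
     emeasure (sphere_measure :: 'a measure) (sphere 0 1) = ennreal (2 * pi)"
  by (simp add: emeasure_sphere_measure_UNIV unit_ball_vol_2)

lemma sphere_measure_sphere:
  "DIM('a::euclidean_space) = 3 \<Longrightarrow>
     emeasure (sphere_measure :: 'a measure) (sphere 0 1) = ennreal (4 * pi)"
  by (simp add: emeasure_sphere_measure_UNIV unit_ball_vol_3)

text \<open>
  A basis with \<open>n\<close> directions is a family indexed by a finite type of cardinality \<open>n\<close>.
  Repeated directions are allowed.
\<close>

definition directional_basis :: "('n::finite \<Rightarrow> 'a::euclidean_space) \<Rightarrow> bool" where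
  "directional_basis D \<longleftrightarrow> (\<forall>i. D i \<in> sphere 0 1)"

definition kernel_sum ::
    "(real \<Rightarrow> real) \<Rightarrow> ('n::finite \<Rightarrow> 'a::euclidean_space) \<Rightarrow> 'a \<Rightarrow> real" where
  "kernel_sum \<psi> D \<theta> = (\<Sum>j\<in>UNIV. \<psi> (\<theta> \<bullet> D j))"

definition weight ::
    "(real \<Rightarrow> real) \<Rightarrow> ('n::finite \<Rightarrow> 'a::euclidean_space) \<Rightarrow> 'n \<Rightarrow> 'a \<Rightarrow> real" where
  "weight \<psi> D i \<theta> = \<psi> (\<theta> \<bullet> D i) / kernel_sum \<psi> D \<theta>"

definition feature ::
    "(real \<Rightarrow> real) \<Rightarrow> ('n::finite \<Rightarrow> 'a::euclidean_space) \<Rightarrow> ('a \<Rightarrow> real) \<Rightarrow> 'n \<Rightarrow> real" where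
  "feature \<psi> D f i = (\<integral>\<theta>. f \<theta> * weight \<psi> D i \<theta> \<partial>sphere_measure)"

definition feature_vector ::
    "(real \<Rightarrow> real) \<Rightarrow> ('n::finite \<Rightarrow> 'a::euclidean_space) \<Rightarrow> ('a \<Rightarrow> real) \<Rightarrow> real ^ 'n" where
  "feature_vector \<psi> D f = (\<chi> i. feature \<psi> D f i)"

definition basis_distance ::
    "('n::finite \<Rightarrow> 'a::euclidean_space) \<Rightarrow> ('n \<Rightarrow> 'a) \<Rightarrow> real" where
  "basis_distance D D' = Max (range (\<lambda>i. norm (D i - D' i)))"

definition Z_min ::
    "(real \<Rightarrow> real) \<Rightarrow> ('n::finite \<Rightarrow> 'a::euclidean_space) \<Rightarrow> ('n \<Rightarrow> 'a) \<Rightarrow> real" where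
  "Z_min \<psi> D D' = (INF \<theta>\<in>sphere 0 1. min (kernel_sum \<psi> D \<theta>) (kernel_sum \<psi> D' \<theta>))"

definition L1_norm :: "('a::euclidean_space \<Rightarrow> real) \<Rightarrow> real" where
  "L1_norm f = (\<integral>\<theta>. \<bar>f \<theta>\<bar> \<partial>sphere_measure)"

end

theory Submission
  imports Defs
begin

text \<open>
  Write \<open>a / S\<close> and \<open>b / S'\<close> for the two weights at a point of the sphere. Then
  \<open>a / S - b / S' = ((a - b) + (b / S') (S' - S)) / S\<close>. As \<open>b / S'\<close> lies in \<open>[0, 1]\<close>, \<open>S\<close> is at
  least \<open>Z_min\<close>, and \<open>a - b\<close> and \<open>S' - S\<close> are bounded by \<open>L \<delta>\<close> and \<open>n L \<delta>\<close>, the weights differ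
  by at most \<open>(n + 1) L \<delta> / Z_min\<close>. Integrating this against \<open>f\<close> gives the bound on the components.
\<close>

text \<open>By Cauchy-Schwarz. It keeps every argument of the kernel inside the interval on which
  \<open>\<psi>\<close> is assumed nonnegative and Lipschitz.\<close>

lemma inner_unit_mem:
  fixes x y :: "'a::real_inner"
  assumes "norm x = 1" "norm y = 1"
  shows "x \<bullet> y \<in> {-1..1}"
  using Cauchy_Schwarz_ineq2[of x y] assms by (auto simp: abs_le_iff)

text \<open>The fraction \<open>b / T\<close> is kept whole and bounded by 1, so the error is
  divided by \<open>Z\<close> only once; bounding both reciprocals separately would cost a factor
  \<open>1 / Z^2\<close>.\<close>

lemma abs_divide_diff_le:
  fixes a b S T :: real
  assumes "0 \<le> b" "b \<le> T" "0 < T" "0 < Z" "Z \<le> S" "\<bar>a - b\<bar> \<le> e" "\<bar>S - T\<bar> \<le> k"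
  shows "\<bar>a / S - b / T\<bar> \<le> (e + k) / Z"
proof -
  have "a / S - b / T = ((a - b) + b / T * (T - S)) / S"
    using assms by (simp add: field_simps)
  moreover have "\<bar>b / T * (T - S)\<bar> \<le> 1 * k"
    unfolding abs_mult using assms by (intro mult_mono) (auto simp: abs_minus_commute)
  then have "\<bar>(a - b) + b / T * (T - S)\<bar> \<le> e + k"
    using assms by linarith
  ultimately have "\<bar>a / S - b / T\<bar> = \<bar>(a - b) + b / T * (T - S)\<bar> / S"
    using assms by (simp add: abs_divide)
  also have "\<dots> \<le> (e + k) / Z"
    using assms \<open>\<bar>(a - b) + b / T * (T - S)\<bar> \<le> e + k\<close> by (intro frac_le) auto
  finally show ?thesis .
qed

lemma abs_integral_mult_diff_le:
  fixes f g h :: "'a \<Rightarrow> real"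
  assumes f: "integrable M f"
    and g: "integrable M (\<lambda>x. f x * g x)" and h: "integrable M (\<lambda>x. f x * h x)"
    and le: "\<And>x. x \<in> space M \<Longrightarrow> \<bar>g x - h x\<bar> \<le> c"
  shows "\<bar>(\<integral>x. f x * g x \<partial>M) - (\<integral>x. f x * h x \<partial>M)\<bar> \<le> c * (\<integral>x. \<bar>f x\<bar> \<partial>M)"
proof -
  \<comment> \<open>A Bochner integral defaults to 0 on a non-integrable function, so merging the
    two integrals uses integrability of both products.\<close>
  have "\<bar>(\<integral>x. f x * g x \<partial>M) - (\<integral>x. f x * h x \<partial>M)\<bar> = \<bar>\<integral>x. f x * g x - f x * h x \<partial>M\<bar>"
    using g h by simp
  also have "\<dots> \<le> (\<integral>x. \<bar>f x * g x - f x * h x\<bar> \<partial>M)"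
    by (rule integral_abs_bound)
  also have "\<dots> \<le> (\<integral>x. c * \<bar>f x\<bar> \<partial>M)"
  proof (rule integral_mono)
    fix x assume "x \<in> space M"
    then have "\<bar>f x\<bar> * \<bar>g x - h x\<bar> \<le> \<bar>f x\<bar> * c"
      by (intro mult_left_mono le) auto
    then show "\<bar>f x * g x - f x * h x\<bar> \<le> c * \<bar>f x\<bar>"
      by (simp add: mult.commute flip: abs_mult right_diff_distrib)
  qed (use f g h in auto)
  finally show ?thesis by simp
qed

text \<open>The Euclidean norm is monotone in the absolute values of the coordinates, and the
  constant vector \<open>c\<close> has norm \<open>sqrt n * c\<close>.\<close>

lemma norm_vec_le_sqrt_card:
  fixes x :: "real ^ 'n"
  assumes "\<And>i. \<bar>x $ i\<bar> \<le> c"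
  shows "norm x \<le> sqrt (real CARD('n)) * c"
proof -
  \<comment> \<open>The index type is nonempty, so some coordinate gives a nonnegative lower bound
    for \<open>c\<close>.\<close>
  have "0 \<le> c"
    using assms abs_ge_zero order_trans by blast
  have "norm x \<le> L2_set (\<lambda>_. c) (UNIV :: 'n set)"
    unfolding norm_vec_def by (rule L2_set_mono) (use assms in auto)
  then show ?thesis
    using \<open>0 \<le> c\<close> by (simp add: L2_set_def real_sqrt_mult)
qed

context
  fixes \<psi> :: "real \<Rightarrow> real" and L :: real
  assumes nonneg: "\<And>t. t \<in> {-1..1} \<Longrightarrow> \<psi> t \<ge> 0"
    and lipschitz: "L-lipschitz_on {-1..1} \<psi>"
begin

lemma kernel_nonneg:
  assumes "directional_basis D" "\<theta> \<in> sphere 0 1"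
  shows "0 \<le> \<psi> (\<theta> \<bullet> D i)"
  using assms by (intro nonneg inner_unit_mem) (auto simp: directional_basis_def)

lemma kernel_le_kernel_sum:
  assumes "directional_basis D" "\<theta> \<in> sphere 0 1"
  shows "\<psi> (\<theta> \<bullet> D i) \<le> kernel_sum \<psi> D \<theta>"
  unfolding kernel_sum_def by (rule member_le_sum) (use kernel_nonneg assms in auto)

text \<open>For a unit vector \<open>\<theta>\<close> the map
  \<open>v \<mapsto> \<theta> \<bullet> v\<close> is 1-Lipschitz, so composing it with
  \<open>\<psi>\<close> keeps the constant \<open>L\<close>.\<close>

lemma kernel_diff_le:
  assumes "directional_basis D" "directional_basis D'" "\<theta> \<in> sphere 0 1"
  shows "\<bar>\<psi> (\<theta> \<bullet> D i) - \<psi> (\<theta> \<bullet> D' i)\<bar> \<le> L * basis_distance D D'"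
proof -
  have "\<bar>\<psi> (\<theta> \<bullet> D i) - \<psi> (\<theta> \<bullet> D' i)\<bar> \<le> L * \<bar>\<theta> \<bullet> D i - \<theta> \<bullet> D' i\<bar>"
    using lipschitz_onD[OF lipschitz inner_unit_mem inner_unit_mem, of \<theta> "D i" \<theta> "D' i"] assms
    by (simp add: directional_basis_def dist_real_def)
  also have "\<bar>\<theta> \<bullet> D i - \<theta> \<bullet> D' i\<bar> \<le> norm (D i - D' i)"
    using Cauchy_Schwarz_ineq2[of \<theta> "D i - D' i"] assms by (simp add: inner_diff_right)
  also have "\<dots> \<le> basis_distance D D'"
    unfolding basis_distance_def by (rule Max_ge) auto
  finally show ?thesis
    using lipschitz_on_nonneg[OF lipschitz] by (simp add: mult_left_mono)
qed

lemma kernel_sum_diff_le: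
  fixes D D' :: "'n::finite \<Rightarrow> 'a::euclidean_space"
  assumes "directional_basis D" "directional_basis D'" "\<theta> \<in> sphere 0 1"
  shows "\<bar>kernel_sum \<psi> D \<theta> - kernel_sum \<psi> D' \<theta>\<bar> \<le> real CARD('n) * (L * basis_distance D D')"
proof -
  have "\<bar>kernel_sum \<psi> D \<theta> - kernel_sum \<psi> D' \<theta>\<bar> \<le> (\<Sum>j\<in>UNIV. \<bar>\<psi> (\<theta> \<bullet> D j) - \<psi> (\<theta> \<bullet> D' j)\<bar>)"
    unfolding kernel_sum_def by (simp flip: sum_subtractf)
  also have "\<dots> \<le> real CARD('n) * (L * basis_distance D D')"
    by (rule sum_bounded_above) (use kernel_diff_le assms in auto)
  finally show ?thesis .
qed

lemma Z_min_le_kernel_sum: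
  assumes "directional_basis D" "directional_basis D'" "\<theta> \<in> sphere 0 1"
  shows "Z_min \<psi> D D' \<le> kernel_sum \<psi> D \<theta>" "Z_min \<psi> D D' \<le> kernel_sum \<psi> D' \<theta>"
proof -
  \<comment> \<open>A real infimum is known to lie below the values only if these are bounded below;
    here 0 is a bound because the kernel is nonnegative.\<close>
  have "bdd_below ((\<lambda>\<theta>. min (kernel_sum \<psi> D \<theta>) (kernel_sum \<psi> D' \<theta>)) ` sphere 0 1)"
    using kernel_nonneg assms
    by (intro bdd_belowI[where m = 0]) (auto simp: kernel_sum_def intro!: sum_nonneg)
  then have "Z_min \<psi> D D' \<le> min (kernel_sum \<psi> D \<theta>) (kernel_sum \<psi> D' \<theta>)"
    unfolding Z_min_def using assms(3) by (rule cINF_lower)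
  then show "Z_min \<psi> D D' \<le> kernel_sum \<psi> D \<theta>" "Z_min \<psi> D D' \<le> kernel_sum \<psi> D' \<theta>"
    by auto
qed

lemma continuous_on_kernel:
  assumes "directional_basis D"
  shows "continuous_on (sphere 0 1) (\<lambda>\<theta>. \<psi> (\<theta> \<bullet> D i))"
proof (rule continuous_on_compose2[OF lipschitz_on_continuous_on[OF lipschitz]])
  show "(\<lambda>\<theta>. \<theta> \<bullet> D i) ` sphere 0 1 \<subseteq> {-1..1}"
    using assms by (intro image_subsetI inner_unit_mem) (auto simp: directional_basis_def)
qed (intro continuous_intros)

text \<open>The weight is continuous on the sphere, hence measurable, and lies in [0, 1], so
  \<open>f\<close> itself dominates the product.\<close>

lemma integrable_mult_weight:
  fixes D :: "'n::finite \<Rightarrow> 'a::euclidean_space"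
  assumes D: "directional_basis D" and f: "integrable sphere_measure f"
    and pos: "\<And>\<theta>. \<theta> \<in> sphere 0 1 \<Longrightarrow> 0 < kernel_sum \<psi> D \<theta>"
  shows "integrable sphere_measure (\<lambda>\<theta>. f \<theta> * weight \<psi> D i \<theta>)"
proof (rule Bochner_Integration.integrable_bound[OF f])
  have "continuous_on (sphere 0 1) (kernel_sum \<psi> D)"
    unfolding kernel_sum_def by (intro continuous_on_sum continuous_on_kernel D)
  then have "continuous_on (sphere 0 1) (weight \<psi> D i)"
    unfolding weight_def using pos
    by (intro continuous_on_divide continuous_on_kernel D) force+
  then have "weight \<psi> D i \<in> borel_measurable sphere_measure"
    unfolding measurable_cong_sets[OF sets_sphere_measure refl]
    by (rule borel_measurable_continuous_on_restrict)
  then show "(\<lambda>\<theta>. f \<theta> * weight \<psi> D i \<theta>) \<in> borel_measurable sphere_measure"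
    using f by measurable
  show "AE \<theta> in sphere_measure. norm (f \<theta> * weight \<psi> D i \<theta>) \<le> norm (f \<theta>)"
  proof (rule AE_I2)
    fix \<theta> :: 'a assume "\<theta> \<in> space sphere_measure"
    then have "\<theta> \<in> sphere 0 1" by simp
    then have "\<bar>weight \<psi> D i \<theta>\<bar> \<le> 1"
      using kernel_nonneg[OF D, of \<theta> i] kernel_le_kernel_sum[OF D, of \<theta> i] pos[of \<theta>]
      by (simp add: weight_def abs_divide)
    then show "norm (f \<theta> * weight \<psi> D i \<theta>) \<le> norm (f \<theta>)"
      by (simp add: abs_mult mult_left_le)
  qed
qed

lemma feature_diff_le:
  fixes D D' :: "'n::finite \<Rightarrow> 'a::euclidean_space"
  assumes D: "directional_basis D" and D': "directional_basis D'"
    and Z: "Z_min \<psi> D D' > 0" and f: "integrable sphere_measure f"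
  shows "\<bar>feature \<psi> D f i - feature \<psi> D' f i\<bar>
           \<le> (real CARD('n) + 1) * L / Z_min \<psi> D D' * L1_norm f * basis_distance D D'"
proof -
  let ?e = "L * basis_distance D D'"
  have pos: "0 < kernel_sum \<psi> D \<theta>" "0 < kernel_sum \<psi> D' \<theta>" if "\<theta> \<in> sphere 0 1" for \<theta>
    using Z Z_min_le_kernel_sum[OF D D' that] by linarith+
  have "\<bar>weight \<psi> D i \<theta> - weight \<psi> D' i \<theta>\<bar> \<le> (?e + real CARD('n) * ?e) / Z_min \<psi> D D'"
    if "\<theta> \<in> space sphere_measure" for \<theta>
  proof -
    have \<theta>: "\<theta> \<in> sphere 0 1" using that by simp
    show ?thesis
      unfolding weight_def
      \<comment> \<open>\<open>D\<close> supplies \<open>a / S\<close> and \<open>D'\<close>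
        supplies \<open>b / T\<close>. The numerators contribute \<open>?e\<close> and the
        denominators \<open>n * ?e\<close>, which together make the factor
        \<open>n + 1\<close>.\<close>
      by (rule abs_divide_diff_le[OF kernel_nonneg[OF D' \<theta>] kernel_le_kernel_sum[OF D' \<theta>]
            pos(2)[OF \<theta>] Z Z_min_le_kernel_sum(1)[OF D D' \<theta>] kernel_diff_le[OF D D' \<theta>]
            kernel_sum_diff_le[OF D D' \<theta>]])
  qed
  from abs_integral_mult_diff_le[OF f integrable_mult_weight[OF D f pos(1)]
      integrable_mult_weight[OF D' f pos(2)] this]
  show ?thesis
    unfolding feature_def L1_norm_def by (simp add: algebra_simps)
qed

end

theorem proposition12:
  fixes \<psi> :: "real \<Rightarrow> real" and L :: real
    and D D' :: "'n::finite \<Rightarrow> real ^ 'd"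
    and f :: "real ^ 'd \<Rightarrow> real"
  assumes "CARD('d) \<in> {2, 3}"
    and "\<And>t. t \<in> {-1..1} \<Longrightarrow> \<psi> t \<ge> 0"
    and "L-lipschitz_on {-1..1} \<psi>"
    and "directional_basis D" and "directional_basis D'"
    and "Z_min \<psi> D D' > 0"
    and "integrable sphere_measure f"
  shows "(\<forall>i. \<bar>feature \<psi> D f i - feature \<psi> D' f i\<bar>
            \<le> (real CARD('n) + 1) * L / Z_min \<psi> D D' * L1_norm f * basis_distance D D')
       \<and> norm (feature_vector \<psi> D f - feature_vector \<psi> D' f)
            \<le> (real CARD('n) + 1) * sqrt (real CARD('n)) * L / Z_min \<psi> D D'
                * L1_norm f * basis_distance D D'"
proof -
  let ?c = "(real CARD('n) + 1) * L / Z_min \<psi> D D' * L1_norm f * basis_distance D D'"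
  have le: "\<bar>feature \<psi> D f i - feature \<psi> D' f i\<bar> \<le> ?c" for i
    using assms(2-) by (rule feature_diff_le)
  \<comment> \<open>Each coordinate of the difference vector is a feature difference, bounded by the
    same \<open>?c\<close>; this is where \<open>sqrt n\<close> enters.\<close>
  then have "norm (feature_vector \<psi> D f - feature_vector \<psi> D' f) \<le> sqrt (real CARD('n)) * ?c"
    by (intro norm_vec_le_sqrt_card) (simp add: feature_vector_def)
  with le show ?thesis
    by (simp add: mult.commute mult.left_commute)
qed

end
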